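(* For nonnegative integers $m<n$ and an integer $k\ge 1$, let $f_k(m,n)$ denote the number of relatively prime subsets of $\{m+1,m+2,\ldots,n\}$ of cardinality $k$. Then \[ f_k(m,n)=\sum_{d=1}^{n}\mu(d)\binom{[n/d]-[m/d]}{k} \] and \[ 0\le \binom{n-m}{k}-\binom{[n/2]-[m/2]}{k}-f_k(m,n)\le n\binom{[(n-m)/3]+2}{k}. \]
   Context: A nonempty set $A$ of integers is called relatively prime if $\gcd(A)=1$. $\mu$ denotes the Möbius function. For a real number $x$, $[x]$ denotes the greatest integer not exceeding $x$. Binomial coefficients $\binom{a}{k}$ with integers $0\le a<k$ are equal to $0$. *)

theory Defs
  imports "HOL-Computational_Algebra.Computational_Algebra"
begin

definition moebius_mu :: "nat \<Rightarrow> int" where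
  "moebius_mu d = (if squarefree d then (-1) ^ card (prime_factors d) else 0)"

definition relatively_prime_set :: "int set \<Rightarrow> bool" where
  "relatively_prime_set A \<longleftrightarrow> A \<noteq> {} \<and> Gcd A = 1"

definition num_relprime_subsets :: "nat \<Rightarrow> nat \<Rightarrow> nat \<Rightarrow> nat" where
  "num_relprime_subsets k m n =
     card {A. A \<subseteq> {int m + 1..int n} \<and> card A = k \<and> relatively_prime_set A}"

end

theory Submission
  imports Defs
begin

text \<open>For a prime \<open>p dvd g\<close>, pairing the squarefree divisors \<open>d\<close> and \<open>p * d\<close> of \<open>g\<close> shows that the sum
  of \<open>\<mu> d\<close> over \<open>d dvd g\<close> vanishes unless \<open>g = 1\<close>. Taking \<open>g = Gcd A\<close>, summing over all \<open>k\<close>-subsets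
  \<open>A\<close> of \<open>{m+1..n}\<close> and exchanging sums gives the formula, because the \<open>A\<close> with \<open>d dvd Gcd A\<close> are the
  \<open>k\<close>-subsets of the \<open>[n/d] - [m/d]\<close> multiples of \<open>d\<close>.
  The middle quantity of the estimate counts the \<open>k\<close>-subsets whose gcd is odd and at least 3. Each of
  these consists of multiples of some \<open>d\<close> with \<open>3 \<le> d \<le> n\<close>, of which there are at most
  \<open>[(n-m)/d] + 1 \<le> [(n-m)/3] + 2\<close>.\<close>

lemma moebius_mu_1: "moebius_mu 1 = 1"
  by (simp add: moebius_mu_def)

text \<open>Since \<open>p\<close> is coprime to \<open>d\<close>, multiplying by it preserves
  squarefreeness in both directions and adds exactly one new prime factor. If \<open>d\<close> is
  not squarefree, both sides are 0.\<close>

lemma moebius_mu_prime_times: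
  assumes "prime p" "\<not> p dvd d"
  shows "moebius_mu (p * d) = - moebius_mu d"
proof -
  have d: "d \<noteq> 0" using assms by (intro notI) auto
  have cop: "coprime p d" using assms prime_imp_coprime by blast
  have pf: "prime_factors (p * d) = insert p (prime_factors d)"
    using d assms(1) by (simp add: prime_factors_product prime_prime_factors prime_gt_0_nat)
  have "p \<notin> prime_factors d" using assms(2) by auto
  moreover have "squarefree (p * d) \<longleftrightarrow> squarefree d"
    using squarefree_mult_coprime[OF cop] squarefree_multD(2)[of p d] squarefree_prime[of p] assms(1)
    by blast
  ultimately show ?thesis unfolding moebius_mu_def pf by simp
qed

lemma sum_moebius_mu_divisors:
  fixes g :: nat
  assumes "g > 0"
  shows "(\<Sum>d | d dvd g. moebius_mu d) = (if g = 1 then 1 else 0)"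
proof (cases "g = 1")
  case True
  then show ?thesis using moebius_mu_1 by simp
next
  case False
  then obtain p where p: "prime p" "p dvd g" using prime_factor_nat by blast
  let ?C = "{d. d dvd g \<and> squarefree d}"
  let ?D = "{d. d dvd g \<and> squarefree d \<and> \<not> p dvd d}"
  have fin: "finite {d. d dvd g}" using assms by simp
  \<comment> \<open>Squarefreeness makes the pairing exact: the cofactor \<open>e\<close> of a
    squarefree \<open>p * e\<close> is itself prime to \<open>p\<close>. Conversely, for
    \<open>e\<close> prime to \<open>p\<close>, both \<open>p\<close> and \<open>e\<close> divide
    \<open>g\<close>, so coprimality gives \<open>p * e dvd g\<close>.\<close>
  have split: "?C = ?D \<union> (\<lambda>d. p * d) ` ?D" (is "_ = _ \<union> ?E")
  proof (intro equalityI subsetI)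
    fix d assume d: "d \<in> ?C"
    show "d \<in> ?D \<union> ?E"
    proof (cases "p dvd d")
      case True
      then obtain e where e: "d = p * e" by blast
      have "\<not> p dvd e"
      proof
        assume "p dvd e"
        then have "p ^ 2 dvd d" using e by (simp add: power2_eq_square)
        then show False using d p(1) by (auto simp: squarefree_def)
      qed
      moreover have "squarefree e" using d e squarefree_multD(2) by blast
      moreover have "e dvd g" using d e dvd_mult_right by blast
      ultimately show ?thesis using e by blast
    qed (use d in blast)
  next
    fix d assume "d \<in> ?D \<union> ?E"
    then show "d \<in> ?C"
    proof
      assume "d \<in> ?E"
      then obtain e where e: "d = p * e" "e \<in> ?D" by blast
      then have cop: "coprime p e" using p(1) prime_imp_coprime by blast
      then have "p * e dvd g" using p(2) e(2) divides_mult by blast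
      moreover have "squarefree (p * e)"
        using squarefree_mult_coprime[OF cop] e(2) p(1) by (auto simp: squarefree_prime)
      ultimately show ?thesis using e(1) by simp
    qed blast
  qed
  have "(\<Sum>d | d dvd g. moebius_mu d) = (\<Sum>d\<in>?C. moebius_mu d)"
    by (rule sum.mono_neutral_right) (use fin in \<open>auto simp: moebius_mu_def\<close>)
  also have "\<dots> = (\<Sum>d\<in>?D. moebius_mu d) + (\<Sum>d\<in>?E. moebius_mu d)"
    unfolding split by (rule sum.union_disjoint) (use fin in auto)
  also have "(\<Sum>d\<in>?E. moebius_mu d) = (\<Sum>d\<in>?D. moebius_mu (p * d))"
    by (subst sum.reindex) (use p(1) in \<open>auto simp: inj_on_def\<close>)
  also have "\<dots> = - (\<Sum>d\<in>?D. moebius_mu d)"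
    using p(1) by (simp add: moebius_mu_prime_times sum_negf)
  finally show ?thesis using False by simp
qed

text \<open>A multiple \<open>d * q\<close> lies in the interval iff
  \<open>m div d < q \<le> n div d\<close>. For \<open>m > n\<close> the interval is empty and the
  truncated difference is 0 as well.\<close>

lemma card_multiples:
  fixes d m n :: nat
  assumes "d > 0"
  shows "card {x \<in> {int m + 1..int n}. int d dvd x} = n div d - m div d"
proof -
  have "{x \<in> {int m + 1..int n}. int d dvd x} = (\<lambda>q. int (d * q)) ` {m div d<..n div d}"
  proof (intro equalityI subsetI)
    fix x assume x: "x \<in> {x \<in> {int m + 1..int n}. int d dvd x}"
    then obtain y where y: "x = int y" using nonneg_int_cases[of x] by auto
    with x obtain q where q: "y = d * q" by auto
    have "m < q * d" "q * d \<le> n" using x y q by (simp_all add: mult.commute flip: of_nat_mult)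
    then have "q \<in> {m div d<..n div d}"
      using assms by (simp add: div_less_iff_less_mult less_eq_div_iff_mult_less_eq)
    then show "x \<in> (\<lambda>q. int (d * q)) ` {m div d<..n div d}" using y q by blast
  next
    fix x assume "x \<in> (\<lambda>q. int (d * q)) ` {m div d<..n div d}"
    then obtain q where q: "x = int (d * q)" "m div d < q" "q \<le> n div d"
      unfolding image_iff Bex_def greaterThanAtMost_iff by blast
    then have "m < d * q" "d * q \<le> n"
      using assms by (simp_all add: div_less_iff_less_mult less_eq_div_iff_mult_less_eq mult.commute)
    then show "x \<in> {x \<in> {int m + 1..int n}. int d dvd x}"
      using q(1) by (simp flip: of_nat_mult)
  qed
  moreover have "inj_on (\<lambda>q. int (d * q)) {m div d<..n div d}" using assms by (simp add: inj_on_def)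
  ultimately show ?thesis by (simp add: card_image del: of_nat_mult)
qed

text \<open>A number divides the gcd of a set iff it divides every element, so the elements are
  chosen freely among the multiples of \<open>d\<close>. The case \<open>k = 0\<close> fits because
  \<open>Gcd {} = 0\<close>.\<close>

lemma card_subsets_of_multiples:
  fixes d m n k :: nat
  assumes "d > 0"
  shows "card {A. A \<subseteq> {int m + 1..int n} \<and> card A = k \<and> int d dvd Gcd A}
           = (n div d - m div d) choose k"
proof -
  have "{A. A \<subseteq> {int m + 1..int n} \<and> card A = k \<and> int d dvd Gcd A}
      = {A. A \<subseteq> {x \<in> {int m + 1..int n}. int d dvd x} \<and> card A = k}"
    by (auto simp: dvd_Gcd_iff)
  moreover have "finite {x \<in> {int m + 1..int n}. int d dvd x}" by (rule finite_Collect_conjI) simp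
  ultimately show ?thesis by (simp only: n_subsets card_multiples[OF assms])
qed

lemma Gcd_bounds:
  fixes A :: "int set"
  assumes "A \<subseteq> {int m + 1..int n}" "A \<noteq> {}"
  shows "0 < Gcd A" "Gcd A \<le> int n"
proof -
  obtain a where a: "a \<in> A" using assms by blast
  then have "0 < a" "a \<le> int n" using assms(1) by force+
  moreover have "Gcd A dvd a" using a by simp
  ultimately show "0 < Gcd A" "Gcd A \<le> int n"
    using zdvd_imp_le[of "Gcd A" a] by (auto simp: order_less_le)
qed

text \<open>Writing \<open>n = m + (n - m)\<close>, the quotients by \<open>d\<close> add up to
  \<open>n div d\<close> except for a carry. The two remainders sum to less than
  \<open>2 * d\<close>, so this carry is at most 1.\<close>

lemma div_diff_le:
  fixes m n d :: nat
  assumes "m \<le> n" "d \<ge> 3"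
  shows "n div d - m div d \<le> (n - m) div 3 + 2"
proof -
  have "m mod d + (n - m) mod d < 2 * d"
    using assms by (simp add: mult_2 add_strict_mono)
  then have "(m mod d + (n - m) mod d) div d < 2" by (rule less_mult_imp_div_less)
  then have "n div d \<le> m div d + (n - m) div d + 1"
    using div_add1_eq[of m "n - m" d] assms(1) by simp
  also have "(n - m) div d \<le> (n - m) div 3" using assms by (intro div_le_mono2) auto
  finally show ?thesis by simp
qed

theorem theorem2:
  fixes m n k :: nat
  assumes "m < n" and "k \<ge> 1"
  shows "int (num_relprime_subsets k m n)
           = (\<Sum>d = 1..n. moebius_mu d * int ((n div d - m div d) choose k))
       \<and> 0 \<le> int ((n - m) choose k) - int ((n div 2 - m div 2) choose k)
              - int (num_relprime_subsets k m n)
       \<and> int ((n - m) choose k) - int ((n div 2 - m div 2) choose k)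
              - int (num_relprime_subsets k m n)
           \<le> int n * int (((n - m) div 3 + 2) choose k)"
proof -
  define S where "S = {A. A \<subseteq> {int m + 1..int n} \<and> card A = k}"
  define N where "N d = {A \<in> S. int d dvd Gcd A}" for d
  define R where "R = {A \<in> S. Gcd A = 1}"
  have finS: "finite S" unfolding S_def by simp
  have fin: "finite (N d)" "finite R" for d using finS by (simp_all add: N_def R_def)
  have bnd: "0 < Gcd A" "Gcd A \<le> int n" if "A \<in> S" for A
  proof -
    \<comment> \<open>Here \<open>k \<ge> 1\<close> rules out the empty set, whose gcd is 0.\<close>
    have "A \<noteq> {}" using that assms(2) by (auto simp: S_def)
    then show "0 < Gcd A" "Gcd A \<le> int n" using that Gcd_bounds[of A m n] by (auto simp: S_def)
  qed
  have f: "num_relprime_subsets k m n = card R"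
  proof -
    have "{A. A \<subseteq> {int m + 1..int n} \<and> card A = k \<and> relatively_prime_set A} = R"
      using assms(2) by (auto simp: relatively_prime_set_def R_def S_def)
    then show ?thesis by (simp add: num_relprime_subsets_def)
  qed
  have cN: "card (N d) = (n div d - m div d) choose k" if "d > 0" for d
    using card_subsets_of_multiples[OF that, of m n k] by (simp add: N_def S_def conj_assoc)
  have cS: "card S = (n - m) choose k"
    using n_subsets[of "{int m + 1..int n}" k] assms(1) by (simp add: S_def flip: of_nat_diff)
  have "(\<Sum>d = 1..n. moebius_mu d * int ((n div d - m div d) choose k))
      = (\<Sum>d = 1..n. \<Sum>A\<in>S. if int d dvd Gcd A then moebius_mu d else 0)"
  proof (intro sum.cong refl)
    fix d assume "d \<in> {1..n}"
    then show "moebius_mu d * int ((n div d - m div d) choose k)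
        = (\<Sum>A\<in>S. if int d dvd Gcd A then moebius_mu d else 0)"
      \<comment> \<open>Read backwards, \<open>cN\<close> turns the binomial coefficient into
        \<open>card (N d)\<close>, a sum of ones over the sets in \<open>S\<close> whose gcd is a
        multiple of \<open>d\<close>.\<close>
      using finS by (simp add: cN[symmetric] N_def sum.inter_filter[symmetric])
  qed
  also have "\<dots> = (\<Sum>A\<in>S. \<Sum>d = 1..n. if int d dvd Gcd A then moebius_mu d else 0)"
    by (rule sum.swap)
  also have "\<dots> = (\<Sum>A\<in>S. if Gcd A = 1 then 1 else 0)"
  proof (intro sum.cong refl)
    fix A assume A: "A \<in> S"
    define g where "g = nat (Gcd A)"
    have g: "Gcd A = int g" "g > 0" "g \<le> n" using bnd[OF A] by (auto simp: g_def)
    have "(\<Sum>d = 1..n. if int d dvd Gcd A then moebius_mu d else 0) = (\<Sum>d\<in>{d\<in>{1..n}. d dvd g}. moebius_mu d)"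
      by (simp add: g(1) sum.inter_filter[symmetric])
    \<comment> \<open>Because \<open>0 < g \<le> n\<close>, cutting the sum off at \<open>n\<close>
      loses no divisor of \<open>g\<close>, whichever \<open>A\<close> is considered.\<close>
    also have "{d\<in>{1..n}. d dvd g} = {d. d dvd g}"
      using g(2,3) by (auto dest: dvd_imp_le intro: Nat.gr0I simp: Suc_le_eq)
    also have "(\<Sum>d | d dvd g. moebius_mu d) = (if Gcd A = 1 then 1 else 0)"
      using sum_moebius_mu_divisors[OF g(2)] by (simp add: g(1))
    finally show "(\<Sum>d = 1..n. if int d dvd Gcd A then moebius_mu d else 0)
        = (if Gcd A = 1 then 1 else 0)" .
  qed
  also have "\<dots> = int (card R)"
    using finS by (simp add: R_def sum.inter_filter[symmetric])
  finally have formula: "int (card R)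
      = (\<Sum>d = 1..n. moebius_mu d * int ((n div d - m div d) choose k))" ..

  define Q where "Q = S - (N 2 \<union> R)"
  have "N 2 \<union> R \<subseteq> S" by (auto simp: N_def R_def)
  then have "card Q + card (N 2 \<union> R) = card S"
    unfolding Q_def using finS fin by (simp add: card_Diff_subset card_mono)
  \<comment> \<open>Disjoint, as 2 does not divide 1. The middle quantity thus equals
    \<open>card Q\<close>, which already gives the lower bound 0.\<close>
  moreover have "card (N 2 \<union> R) = card (N 2) + card R"
    by (intro card_Un_disjoint fin) (auto simp: N_def R_def)
  ultimately have cQ: "int (card Q)
      = int ((n - m) choose k) - int ((n div 2 - m div 2) choose k) - int (card R)"
    using cS cN[of 2] by simp
  have "Q \<subseteq> (\<Union>d\<in>{3..n}. N d)"
  proof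
    fix A assume A: "A \<in> Q"
    then have AS: "A \<in> S" by (simp add: Q_def)
    \<comment> \<open>The gcd itself serves as the index \<open>d\<close>: it is positive, and the
      values 1 and 2 would put \<open>A\<close> into \<open>R\<close> or \<open>N 2\<close>.\<close>
    have "Gcd A \<noteq> 1" "Gcd A \<noteq> 2" using A by (auto simp: Q_def N_def R_def)
    then have "nat (Gcd A) \<in> {3..n}" "A \<in> N (nat (Gcd A))"
      using bnd[OF AS] AS by (auto simp: N_def)
    then show "A \<in> (\<Union>d\<in>{3..n}. N d)" by blast
  qed
  then have "card Q \<le> card (\<Union>d\<in>{3..n}. N d)"
    using fin by (intro card_mono) auto
  also have "\<dots> \<le> (\<Sum>d\<in>{3..n}. card (N d))" by (rule card_UN_le) simp
  also have "\<dots> \<le> (\<Sum>d\<in>{3..n}. ((n - m) div 3 + 2) choose k)"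
  proof (intro sum_mono)
    fix d assume "d \<in> {3..n}"
    then have "n div d - m div d \<le> (n - m) div 3 + 2" "d > 0"
      using assms(1) div_diff_le by auto
    then show "card (N d) \<le> ((n - m) div 3 + 2) choose k"
      unfolding cN[OF \<open>d > 0\<close>] by (intro binomial_right_mono)
  qed
  \<comment> \<open>The summand is constant and \<open>{3..n}\<close> has at most \<open>n\<close>
    elements.\<close>
  also have "\<dots> \<le> n * (((n - m) div 3 + 2) choose k)" by simp
  finally have "int (card Q) \<le> int n * int (((n - m) div 3 + 2) choose k)"
    by (metis of_nat_le_iff of_nat_mult)
  then show ?thesis using formula cQ f by auto
qed

end
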